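(* Let $G$ be a graph with $|V(G)|\ge 9$. If $\Delta(G)+\delta(G)\ge |V(G)|-2$, then $G$ admits an antimagic orientation.
   Context: All graphs are finite and simple; graphs are not assumed connected unless stated. $\Delta(G)$ and $\delta(G)$ denote the maximum and minimum degree of $G$. For a digraph $D$ with $m$ arcs, arc set $A(D)$, and a bijection $\tau:A(D)\to\{1,2,\ldots,m\}$, the vertex-sum $s_{(D,\tau)}(u)$ of a vertex $u$ is the sum of the labels of all arcs entering $u$ minus the sum of the labels of all arcs leaving $u$ (and $s_{(D,\tau)}(u):=0$ if $u$ is isolated). The bijection $\tau$ is an antimagic labeling of $D$ if $s_{(D,\tau)}(u)\ne s_{(D,\tau)}(v)$ for all distinct vertices $u,v$ of $D$. An antimagic orientation of a graph $G$ is a pair $(D,\tau)$ where $D$ is an orientation of $G$ (each edge of $G$ is replaced by exactly one of its two possible arcs) and $\tau$ is an antimagic labeling of $D$. *)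

theory Defs
  imports Complex_Main "Graph_Theory.Pair_Digraph"
begin

text \<open>
  Following Graph_Theory, a finite simple graph is a \<open>pair_graph\<close>, i.e. a finite
  loop-free symmetric digraph: an edge between \<open>u\<close> and \<open>v\<close> is represented
  by the two arcs \<open>(u, v)\<close> and \<open>(v, u)\<close>. The degree of a vertex
  is therefore its out-degree.
\<close>

definition max_degree :: "'a pair_pre_digraph \<Rightarrow> nat" where
  "max_degree G = Max (out_degree (with_proj G) ` pverts G)"

definition min_degree :: "'a pair_pre_digraph \<Rightarrow> nat" where
  "min_degree G = Min (out_degree (with_proj G) ` pverts G)"

definition is_orientation :: "'a pair_pre_digraph \<Rightarrow> 'a pair_pre_digraph \<Rightarrow> bool" where
  "is_orientation G D \<longleftrightarrow>
     pverts D = pverts G \<and> parcs D \<subseteq> parcs G \<and>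
     (\<forall>u v. (u, v) \<in> parcs G \<longrightarrow> ((u, v) \<in> parcs D \<longleftrightarrow> (v, u) \<notin> parcs D))"

text \<open>At an isolated vertex both sums are empty, so its vertex-sum is 0.\<close>

definition vertex_sum :: "'a pair_pre_digraph \<Rightarrow> ('a \<times> 'a \<Rightarrow> nat) \<Rightarrow> 'a \<Rightarrow> int" where
  "vertex_sum D \<tau> u =
     (\<Sum>e \<in> in_arcs (with_proj D) u. int (\<tau> e)) - (\<Sum>e \<in> out_arcs (with_proj D) u. int (\<tau> e))"

definition antimagic_labeling :: "'a pair_pre_digraph \<Rightarrow> ('a \<times> 'a \<Rightarrow> nat) \<Rightarrow> bool" where
  "antimagic_labeling D \<tau> \<longleftrightarrow>
     bij_betw \<tau> (parcs D) {1..card (parcs D)} \<and>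
     (\<forall>u \<in> pverts D. \<forall>v \<in> pverts D. u \<noteq> v \<longrightarrow> vertex_sum D \<tau> u \<noteq> vertex_sum D \<tau> v)"

definition antimagic_orientation ::
    "'a pair_pre_digraph \<Rightarrow> 'a pair_pre_digraph \<times> ('a \<times> 'a \<Rightarrow> nat) \<Rightarrow> bool" where
  "antimagic_orientation G = (\<lambda>(D, \<tau>). is_orientation G D \<and> antimagic_labeling D \<tau>)"

end

theory Submission
  imports Defs
begin

text \<open>
  A labelling is built by listing the arcs of the orientation in order of their labels, so that
  appending an arc to the list gives it the next label and leaves all earlier labels alone. Three
  observations carry the proof.

  First, every graph on \<open>m\<close> edges has a labelled orientation in which no vertex-sum is below
  \<open>-m\<close> (\<open>lower_bounded_orientation\<close>): walk along trails against the direction of the arcs, so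
  that at each passage through a vertex the outgoing arc is labelled just before the incoming one.
  Only the vertex where a trail stops can have a negative sum, and there all edges are used up.

  Second, if each vertex of a set \<open>S\<close> keeps one unlabelled edge to the outside of \<open>S\<close>, all of
  them directed into \<open>S\<close>, then handing out the next labels in the order of the current sums makes
  the sums on \<open>S\<close> distinct and raises each of them by more than the number of labels used before
  (\<open>star_extension\<close>).

  Third, let \<open>x\<close> have maximum degree, and let \<open>M\<close> be the set of vertices other than \<open>x\<close> that are
  not adjacent to \<open>x\<close>. If every vertex of \<open>M\<close> has a neighbour in \<open>N(x)\<close>, direct
  all edges from \<open>M\<close> to \<open>N(x)\<close> and from \<open>x\<close> to \<open>N(x)\<close>. The star extension, used for \<open>M\<close>
  with signs reversed and then for \<open>N(x)\<close> with the largest labels, makes the sums on \<open>M\<close> distinct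
  and negative, those on \<open>N(x)\<close> distinct and positive, and the sum at \<open>x\<close> the smallest of all
  (\<open>antimagic_if_common_neighbours\<close>). Otherwise some \<open>w \<in> M\<close> has all its neighbours in \<open>M\<close>. The
  degree condition gives \<open>\<bar>M\<bar> \<le> \<delta> + 1\<close>, so \<open>w\<close> is adjacent to all the rest of \<open>M\<close>, and the
  vertices are partitioned by two stars with non-adjacent centres \<open>x\<close> and \<open>w\<close>. A single star
  extension then makes the sums of all leaves distinct and positive, while the two centres have sums
  that are not positive; if these two happen to agree, reversing the arc of the least leaf separates
  them (\<open>antimagic_if_two_stars\<close>).
\<close>

section \<open>Arc lists and their vertex-sums\<close>

definition incidence :: "'a \<times> 'a \<Rightarrow> 'a \<Rightarrow> int" where
  "incidence a v = of_bool (snd a = v) - of_bool (fst a = v)"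

text \<open>The vertex-sum when the arc at position \<open>i\<close> of the list, counted from 0, is labelled
  \<open>i + 1\<close>.\<close>

definition list_sum :: "('a \<times> 'a) list \<Rightarrow> 'a \<Rightarrow> int" where
  "list_sum xs v = (\<Sum>i<length xs. int (Suc i) * incidence (xs ! i) v)"

text \<open>The edge set is a symmetric relation, as in the representation of simple graphs by
  symmetric digraphs; the list picks one arc of each opposite pair.\<close>

definition orients :: "('a \<times> 'a) list \<Rightarrow> ('a \<times> 'a) set \<Rightarrow> bool" where
  "orients xs E \<longleftrightarrow> distinct xs \<and> set xs \<subseteq> E \<and>
     (\<forall>u v. (u, v) \<in> E \<longrightarrow> ((u, v) \<in> set xs \<longleftrightarrow> (v, u) \<notin> set xs))"

lemma list_sum_Nil [simp]: "list_sum [] v = 0"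
  by (simp add: list_sum_def)

lemma list_sum_snoc:
  "list_sum (xs @ [a]) v = list_sum xs v + int (Suc (length xs)) * incidence a v"
  by (simp add: list_sum_def nth_append)

lemma list_sum_append:
  "list_sum (xs @ ys) v =
     list_sum xs v + (\<Sum>i<length ys. int (length xs + Suc i) * incidence (ys ! i) v)"
proof (induction ys rule: rev_induct)
  case (snoc a ys)
  then show ?case
    unfolding append_assoc [symmetric] list_sum_snoc by (simp add: nth_append)
qed simp

lemma list_sum_append_ge:
  assumes "\<And>a. a \<in> set ys \<Longrightarrow> fst a \<noteq> v"
  shows "list_sum (xs @ ys) v \<ge> list_sum xs v"
  unfolding list_sum_append using assms
  by (auto intro!: sum_nonneg simp: incidence_def)

lemma list_sum_append_le:
  assumes "\<And>a. a \<in> set ys \<Longrightarrow> snd a \<noteq> v"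
  shows "list_sum (xs @ ys) v \<le> list_sum xs v"
  unfolding list_sum_append using assms
  by (auto intro!: sum_nonpos simp: incidence_def)

lemma list_sum_append_other:
  assumes "\<And>a. a \<in> set ys \<Longrightarrow> fst a \<noteq> v \<and> snd a \<noteq> v"
  shows "list_sum (xs @ ys) v = list_sum xs v"
  using list_sum_append_ge[of ys v xs] list_sum_append_le[of ys v xs] assms by fastforce

lemma sum_incidence:
  assumes "distinct ys"
  shows "(\<Sum>i<length ys. incidence (ys ! i) v) =
    int (card {a \<in> set ys. snd a = v}) - int (card {a \<in> set ys. fst a = v})"
proof -
  have "(\<Sum>i<length ys. incidence (ys ! i) v) = (\<Sum>a\<in>set ys. incidence a v)"
    by (rule sum.reindex_bij_betw[OF bij_betw_nth[OF assms]]) auto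
  also have "\<dots> = (\<Sum>a\<in>set ys. of_bool (snd a = v)) - (\<Sum>a\<in>set ys. of_bool (fst a = v))"
    by (simp add: incidence_def sum_subtractf)
  finally show ?thesis
    by (simp add: sum.If_cases of_bool_def Int_def conj_commute)
qed

text \<open>
  Each appended arc out of a source carries a label larger than \<open>length xs\<close>. This is what makes the
  sum at the centre of a star very negative.
\<close>

lemma list_sum_append_source_le:
  assumes "distinct ys" "\<And>a. a \<in> set ys \<Longrightarrow> snd a \<noteq> v"
  shows "list_sum (xs @ ys) v \<le>
    list_sum xs v - int (length xs + 1) * int (card {a \<in> set ys. fst a = v})"
proof -
  have none: "{a \<in> set ys. snd a = v} = {}"
    using assms(2) by blast
  have "(\<Sum>i<length ys. int (length xs + Suc i) * incidence (ys ! i) v)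
      \<le> (\<Sum>i<length ys. int (length xs + 1) * incidence (ys ! i) v)"
    using assms(2) by (intro sum_mono mult_right_mono_neg) (auto simp: incidence_def)
  also have "\<dots> = - (int (length xs + 1) * int (card {a \<in> set ys. fst a = v}))"
    unfolding sum_distrib_left [symmetric] sum_incidence[OF assms(1)] none by simp
  finally show ?thesis
    unfolding list_sum_append by linarith
qed

text \<open>
  No label exceeds the length of the list and at most the outgoing arcs count negatively. This is
  how the sum at a vertex of maximum degree, taken with larger labels, is kept below the others.
\<close>

lemma list_sum_ge_out_degree:
  assumes "distinct xs"
  shows "list_sum xs v \<ge> - (int (length xs) * int (card {a \<in> set xs. fst a = v}))"
proof -
  have bij: "bij_betw (nth xs) {..<length xs} (set xs)"
    using bij_betw_nth[OF assms] by simp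
  have "- (int (length xs) * int (card {a \<in> set xs. fst a = v}))
      = (\<Sum>a\<in>set xs. - int (length xs) * of_bool (fst a = v))"
    unfolding sum_distrib_left [symmetric]
    by (simp add: sum.If_cases of_bool_def Int_def conj_commute)
  also have "\<dots> = (\<Sum>i<length xs. - int (length xs) * of_bool (fst (xs ! i) = v))"
    by (rule sum.reindex_bij_betw[OF bij, symmetric])
  also have "\<dots> \<le> list_sum xs v"
    unfolding list_sum_def by (intro sum_mono) (auto simp: incidence_def)
  finally show ?thesis .
qed

text \<open>
  When no arc crosses between \<open>M\<close> and its complement, reversing the arcs inside \<open>M\<close> negates the
  sums on \<open>M\<close> alone, so a lower bound becomes an upper bound there and is kept elsewhere.
\<close>

lemma list_sum_flip:
  assumes "\<And>a. a \<in> set xs \<Longrightarrow> fst a \<in> M \<longleftrightarrow> snd a \<in> M"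
  shows "list_sum (map (\<lambda>a. if fst a \<in> M then prod.swap a else a) xs) v =
    (if v \<in> M then - list_sum xs v else list_sum xs v)"
proof -
  have "incidence (map (\<lambda>a. if fst a \<in> M then prod.swap a else a) xs ! i) v =
      (if v \<in> M then - incidence (xs ! i) v else incidence (xs ! i) v)" if "i < length xs" for i
    using assms[OF nth_mem[OF that]] that by (auto simp: incidence_def)
  then show ?thesis
    by (simp add: list_sum_def sum_negf)
qed

lemma list_sum_swap: "list_sum (map prod.swap xs) v = - list_sum xs v"
  using list_sum_flip[of xs UNIV v] by simp

lemma list_sum_reverse_arc:
  "list_sum (xs @ prod.swap a # ys) v =
     list_sum (xs @ a # ys) v - 2 * int (Suc (length xs)) * incidence a v"
proof -
  have "incidence (prod.swap a) v = - incidence a v"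
    by (simp add: incidence_def)
  then show ?thesis
    unfolding list_sum_append
    by (simp add: sum.lessThan_Suc_shift del: sum.lessThan_Suc)
qed

section \<open>Orientations of symmetric relations\<close>

lemma orients_append:
  assumes xs: "orients xs E" and ys: "orients ys F" and "E \<inter> F = {}" "sym E" "sym F"
  shows "orients (xs @ ys) (E \<union> F)"
proof -
  have sub: "set xs \<subseteq> E" "set ys \<subseteq> F"
    using xs ys by (simp_all add: orients_def)
  have "(u, v) \<in> set (xs @ ys) \<longleftrightarrow> (v, u) \<notin> set (xs @ ys)" if "(u, v) \<in> E \<union> F" for u v
  proof (cases "(u, v) \<in> E")
    case True
    then have "(u, v) \<notin> set ys" "(v, u) \<notin> set ys"
      using sub assms(3,4) by (auto dest: symD)
    then show ?thesis using xs True by (simp add: orients_def)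
  next
    case False
    then have "(u, v) \<in> F" "(u, v) \<notin> set xs" "(v, u) \<notin> set xs"
      using that sub assms(3,4) by (auto dest: symD)
    then show ?thesis using ys by (simp add: orients_def)
  qed
  moreover have "distinct (xs @ ys)"
    using xs ys sub assms(3) by (auto simp: orients_def)
  ultimately show ?thesis
    using sub unfolding orients_def by auto
qed

lemma orients_symcl:
  assumes "distinct xs" "set xs \<inter> (set xs)\<inverse> = {}"
  shows "orients xs (set xs \<union> (set xs)\<inverse>)"
  using assms unfolding orients_def by blast

lemma orients_flip:
  assumes "orients xs E" "\<And>u v. (u, v) \<in> E \<Longrightarrow> u \<in> M \<longleftrightarrow> v \<in> M" "sym E"
  shows "orients (map (\<lambda>a. if fst a \<in> M then prod.swap a else a) xs) E"
proof -
  let ?f = "\<lambda>a. if fst a \<in> M then prod.swap a else a"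
  have sub: "set xs \<subseteq> E"
    using assms(1) by (simp add: orients_def)
  have inv: "?f (?f a) = a" if "a \<in> E" for a
    using assms(2) that by (cases a) auto
  have mem: "a \<in> set (map ?f xs) \<longleftrightarrow> ?f a \<in> set xs" if "a \<in> E" for a
  proof
    assume "a \<in> set (map ?f xs)"
    then obtain b where b: "b \<in> set xs" "a = ?f b" unfolding set_map by blast
    then have "?f a = b" using inv[of b] sub by blast
    then show "?f a \<in> set xs" using b(1) by simp
  next
    assume "?f a \<in> set xs"
    then have "?f (?f a) \<in> set (map ?f xs)" unfolding set_map by (rule imageI)
    then show "a \<in> set (map ?f xs)" unfolding inv[OF that] .
  qed
  have inj: "inj_on ?f (set xs)"
    using inv sub by (intro inj_on_inverseI[of _ ?f]) blast
  have img: "set (map ?f xs) \<subseteq> E"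
    using sub assms(3) by (auto simp: sym_def)
  have one: "(u, v) \<in> set (map ?f xs) \<longleftrightarrow> (v, u) \<notin> set (map ?f xs)" if "(u, v) \<in> E" for u v
  proof -
    have vu: "(v, u) \<in> E" using that assms(3) by (auto simp: sym_def)
    have "u \<in> M \<longleftrightarrow> v \<in> M" using assms(2) that by blast
    moreover have "(u, v) \<in> set xs \<longleftrightarrow> (v, u) \<notin> set xs"
      using assms(1) that unfolding orients_def by blast
    ultimately show ?thesis
      unfolding mem[OF that] mem[OF vu] by (cases "u \<in> M") auto
  qed
  have "distinct (map ?f xs)"
    using assms(1) inj by (simp add: orients_def distinct_map)
  then show ?thesis
    unfolding orients_def using img one by blast
qed

section \<open>Orientations with sums bounded from below\<close>

text \<open>
  \<open>R\<close> consists of the edges that are still to be labelled, and \<open>u\<close> is the current end of the trail.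
  The next arc leads from a new vertex \<open>y\<close> into the end of the trail: its label more than compensates
  the negative label that the end may have received in the previous step, and \<open>y\<close> had a nonnegative
  sum because it still had an unlabelled edge. When the trail cannot be continued, a new one is
  started anywhere; the old end may keep a negative sum, as its edges are exhausted.
\<close>

lemma greedy_extension:
  fixes R :: "('a \<times> 'a) set"
  assumes "finite R" "sym R" "irrefl R"
    and "\<And>z. list_sum xs z \<ge> - int (length xs)"
    and "\<And>z. z \<noteq> u \<Longrightarrow> z \<in> Domain R \<Longrightarrow> list_sum xs z \<ge> 0"
  shows "\<exists>ys. orients ys R \<and> (\<forall>z. list_sum (xs @ ys) z \<ge> - int (length (xs @ ys)))"
  using assms
proof (induction "card R" arbitrary: R xs u rule: less_induct)
  case less
  show ?case
  proof (cases "R = {}")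
    case True
    then show ?thesis
      using less.prems(4) by (intro exI[of _ "[]"]) (auto simp: orients_def)
  next
    case False
    \<comment> \<open>\<open>t\<close> is \<open>u\<close> if the trail can be continued, and the start of a new trail otherwise.\<close>
    obtain y t where yt: "(y, t) \<in> R" and nonneg: "\<And>z. z \<noteq> t \<Longrightarrow> z \<in> Domain R \<Longrightarrow> list_sum xs z \<ge> 0"
    proof (cases "u \<in> Domain R")
      case True
      then obtain y where "(y, u) \<in> R" using less.prems(2) by (auto simp: sym_def)
      then show ?thesis using that less.prems(5) by blast
    next
      case nu: False
      obtain y t where "(y, t) \<in> R" using False by auto
      moreover have "list_sum xs z \<ge> 0" if "z \<in> Domain R" for z
        using less.prems(5)[of z] nu that by (cases "z = u") auto
      ultimately show ?thesis using that by blast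
    qed
    have ty: "(t, y) \<in> R" and neq: "y \<noteq> t"
      using yt less.prems(2,3) by (auto simp: sym_def irrefl_def)
    define S where "S = R - {(y, t), (t, y)}"
    define ws where "ws = xs @ [(y, t)]"
    have ws: "list_sum ws z = list_sum xs z +
        (if z = t then int (Suc (length xs)) else if z = y then - int (Suc (length xs)) else 0)" for z
      using neq by (auto simp: ws_def list_sum_snoc incidence_def)
    have ygeq: "list_sum xs y \<ge> 0"
      using nonneg neq yt by blast
    have "\<exists>ys. orients ys S \<and> (\<forall>z. list_sum (ws @ ys) z \<ge> - int (length (ws @ ys)))"
    proof (rule less.hyps[of S ws y])
      have "S \<subset> R" using yt by (auto simp: S_def)
      then show "card S < card R" using less.prems(1) by (simp add: psubset_card_mono)
      show "finite S" "sym S" "irrefl S"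
        using less.prems(1-3) by (auto simp: S_def sym_def irrefl_def)
      show "list_sum ws z \<ge> - int (length ws)" for z
        using less.prems(4)[of z] ygeq unfolding ws by (auto simp: ws_def)
      show "list_sum ws z \<ge> 0" if "z \<noteq> y" "z \<in> Domain S" for z
        using that nonneg[of z] less.prems(4)[of z] unfolding ws by (auto simp: S_def)
    qed
    then obtain ys where ys: "orients ys S" "\<And>z. list_sum (ws @ ys) z \<ge> - int (length (ws @ ys))"
      by blast
    have "orients ((y, t) # ys) R"
      using ys(1) yt ty neq unfolding orients_def S_def by auto
    then show ?thesis
      using ys(2) by (intro exI[of _ "(y, t) # ys"]) (auto simp: ws_def)
  qed
qed

lemma lower_bounded_orientation:
  fixes R :: "('a \<times> 'a) set"
  assumes "finite R" "sym R" "irrefl R"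
  obtains xs where "orients xs R" "\<And>z. list_sum xs z \<ge> - int (length xs)"
  using greedy_extension[of R "[]"] assms by auto

section \<open>Separating sums by a star\<close>

text \<open>
  Adding increasing labels to weakly increasing sums makes them strictly increasing; the arcs of
  different vertices do not interfere, since each has its other endpoint outside \<open>S\<close>. The centre
  \<open>c v\<close> may depend on \<open>v\<close>, which allows for both several stars at once and arbitrarily chosen
  private edges.
\<close>

lemma star_extension:
  assumes "finite S" "\<And>v. v \<in> S \<Longrightarrow> c v \<notin> S"
  obtains vs where "set vs = S" "distinct vs"
    "\<And>i. i < length vs \<Longrightarrow>
       list_sum (xs @ map (\<lambda>v. (c v, v)) vs) (vs ! i) =
       list_sum xs (vs ! i) + int (length xs + Suc i)"
    "\<And>i j. i < j \<Longrightarrow> j < length vs \<Longrightarrow>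
       list_sum (xs @ map (\<lambda>v. (c v, v)) vs) (vs ! i) <
       list_sum (xs @ map (\<lambda>v. (c v, v)) vs) (vs ! j)"
proof -
  obtain us where us: "set us = S" "distinct us"
    using finite_distinct_list[OF assms(1)] by blast
  define vs where "vs = sort_key (list_sum xs) us"
  have vs: "set vs = S" "distinct vs" "sorted (map (list_sum xs) vs)"
    using us by (auto simp: vs_def)
  have eq: "list_sum (xs @ map (\<lambda>v. (c v, v)) vs) (vs ! i) =
      list_sum xs (vs ! i) + int (length xs + Suc i)" if i: "i < length vs" for i
  proof -
    have "incidence (map (\<lambda>v. (c v, v)) vs ! j) (vs ! i) = of_bool (j = i)" if "j < length vs" for j
    proof -
      have "c (vs ! j) \<noteq> vs ! i"
        using assms(2) vs(1) i that by (metis nth_mem)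
      then show ?thesis
        using that i vs(2) by (simp add: incidence_def nth_eq_iff_index_eq)
    qed
    then have "(\<Sum>j<length vs. int (length xs + Suc j) * incidence (map (\<lambda>v. (c v, v)) vs ! j) (vs ! i))
      = (\<Sum>j<length vs. if j = i then int (length xs + Suc j) else 0)"
      by (intro sum.cong) auto
    then show ?thesis
      using i unfolding list_sum_append by simp
  qed
  show ?thesis
  proof (rule that[of vs])
    fix i j assume ij: "i < j" "j < length vs"
    then have "list_sum xs (vs ! i) \<le> list_sum xs (vs ! j)"
      using sorted_nth_mono[OF vs(3), of i j] by simp
    then show "list_sum (xs @ map (\<lambda>v. (c v, v)) vs) (vs ! i) <
       list_sum (xs @ map (\<lambda>v. (c v, v)) vs) (vs ! j)"
      using ij eq[of i] eq[of j] by simp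
  qed (use vs eq in auto)
qed

section \<open>Graphs in which a vertex of maximum degree reaches everything in two steps\<close>

lemma inj_on_UnI:
  assumes A: "inj_on f A" and B: "inj_on f B"
    and ne: "\<And>a b. a \<in> A \<Longrightarrow> b \<in> B \<Longrightarrow> f a \<noteq> f b"
  shows "inj_on f (A \<union> B)"
proof (rule inj_onI)
  fix u v assume uv: "u \<in> A \<union> B" "v \<in> A \<union> B" "f u = f v"
  then consider "u \<in> A" "v \<in> A" | "u \<in> B" "v \<in> B"
    using ne by (metis UnE)
  then show "u = v"
    by cases (use uv(3) A B in \<open>auto dest: inj_onD\<close>)
qed

text \<open>
  The labels are given out in four rounds: first the edges inside \<open>N(x)\<close> and inside \<open>M\<close>, then those
  from \<open>M\<close> to \<open>N(x)\<close> except for one private edge \<open>(w, c w)\<close> for each \<open>w \<in> M\<close>, then the private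
  edges, and finally the edges at \<open>x\<close>. The first round leaves sums of at least \<open>-m\<close> on \<open>N(x)\<close> and
  at most \<open>m\<close> on \<open>M\<close>, where \<open>m\<close> is the number of its edges. The later arcs between the two
  only raise the former and lower the latter, and the label of the private edge or of the edge
  at \<open>x\<close> is larger than \<open>m\<close>, so it decides the sign.
\<close>

lemma antimagic_if_common_neighbours:
  fixes E :: "('a \<times> 'a) set"
  defines "N \<equiv> \<lambda>u. E `` {u}"
  assumes V: "finite V" "E \<subseteq> V \<times> V" and E: "sym E" "irrefl E"
    and x: "x \<in> V" "N x \<noteq> {}" "\<And>u. u \<in> V \<Longrightarrow> card (N u) \<le> card (N x)"
    and far: "\<And>w. w \<in> V \<Longrightarrow> w \<noteq> x \<Longrightarrow> w \<notin> N x \<Longrightarrow> N w \<inter> N x \<noteq> {}"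
  shows "\<exists>xs. orients xs E \<and> inj_on (list_sum xs) V"
proof -
  define M where "M = V - insert x (N x)"
  have fin: "finite E" "finite M" "\<And>u. finite (N u)"
    using V by (auto simp: M_def N_def intro: finite_subset[OF V(2)] finite_subset[of _ V])
  have xNM: "x \<notin> N x" "x \<notin> M" "N x \<inter> M = {}" "V = insert x (N x \<union> M)"
    using V E x by (auto simp: M_def N_def irrefl_def)
  have xM: "(x, w) \<notin> E" "(w, x) \<notin> E" if "w \<in> M" for w
    using that E(1) by (auto simp: M_def N_def sym_def)
  have "\<forall>w\<in>M. \<exists>v. v \<in> N x \<and> (w, v) \<in> E"
    using far by (fastforce simp: M_def N_def)
  then obtain c where c: "\<And>w. w \<in> M \<Longrightarrow> c w \<in> N x \<and> (w, c w) \<in> E"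
    by metis

  define R where "R = E \<inter> (N x \<times> N x \<union> M \<times> M)"
  have R: "finite R" "sym R" "irrefl R"
    using fin(1) E by (auto simp: R_def sym_def irrefl_def)
  obtain xs0 where xs0: "orients xs0 R" "\<And>z. list_sum xs0 z \<ge> - int (length xs0)"
    using lower_bounded_orientation[OF R] by blast
  \<comment> \<open>Reversed inside \<open>M\<close>, where an upper bound on the sums is needed.\<close>
  define xs1 where "xs1 = map (\<lambda>a. if fst a \<in> M then prod.swap a else a) xs0"
  have xs1: "orients xs1 R"
    unfolding xs1_def using xs0(1) R(2) xNM(3) by (intro orients_flip) (auto simp: R_def)
  have sub0: "set xs0 \<subseteq> R"
    using xs0(1) by (simp add: orients_def)
  have sum1: "list_sum xs1 z = (if z \<in> M then - list_sum xs0 z else list_sum xs0 z)" for z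
    unfolding xs1_def using sub0 xNM(3) by (intro list_sum_flip) (fastforce simp: R_def)

  define A where "A = {(w, v) \<in> E. w \<in> M \<and> v \<in> N x \<and> v \<noteq> c w}"
  have "A \<subseteq> E" by (auto simp: A_def)
  then have "finite A" using fin(1) finite_subset by blast
  then obtain as where as: "set as = A" "distinct as"
    using finite_distinct_list by blast
  define xs2 where "xs2 = xs1 @ as"

  have "c w \<notin> M" if "w \<in> M" for w
    using c[OF that] xNM(3) by auto
  \<comment> \<open>The private edges leave \<open>M\<close>, so the star extension is applied to the reversed orientation,
    in which they enter \<open>M\<close> and all sums are negated.\<close>
  from star_extension[of M c "map prod.swap xs2", OF fin(2) this]
  obtain ws where ws: "set ws = M" "distinct ws"
    and ws_eq: "\<And>i. i < length ws \<Longrightarrow>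
       list_sum (map prod.swap xs2 @ map (\<lambda>v. (c v, v)) ws) (ws ! i) =
       list_sum (map prod.swap xs2) (ws ! i) + int (length (map prod.swap xs2) + Suc i)"
    and ws_less: "\<And>i j. i < j \<Longrightarrow> j < length ws \<Longrightarrow>
       list_sum (map prod.swap xs2 @ map (\<lambda>v. (c v, v)) ws) (ws ! i) <
       list_sum (map prod.swap xs2 @ map (\<lambda>v. (c v, v)) ws) (ws ! j)"
    by blast
  define bs where "bs = map (\<lambda>w. (w, c w)) ws"
  define xs3 where "xs3 = xs2 @ bs"
  have "map prod.swap xs2 @ map (\<lambda>v. (c v, v)) ws = map prod.swap xs3"
    by (simp add: xs3_def bs_def)
  note ws_eq = ws_eq[unfolded this list_sum_swap] and ws_less = ws_less[unfolded this list_sum_swap]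

  obtain vs where vs: "set vs = N x" "distinct vs"
    and vs_eq: "\<And>i. i < length vs \<Longrightarrow>
       list_sum (xs3 @ map (\<lambda>v. (x, v)) vs) (vs ! i) =
       list_sum xs3 (vs ! i) + int (length xs3 + Suc i)"
    and vs_less: "\<And>i j. i < j \<Longrightarrow> j < length vs \<Longrightarrow>
       list_sum (xs3 @ map (\<lambda>v. (x, v)) vs) (vs ! i) <
       list_sum (xs3 @ map (\<lambda>v. (x, v)) vs) (vs ! j)"
    using star_extension[of "N x" "\<lambda>_. x" xs3] fin(3) xNM(1) by blast
  define cs where "cs = map (\<lambda>v. (x, v)) vs"
  define xs4 where "xs4 = xs3 @ cs"
  note vs_eq = vs_eq[folded cs_def xs4_def] and vs_less = vs_less[folded cs_def xs4_def]
  have bs: "set bs = (\<lambda>w. (w, c w)) ` M" "distinct bs"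
    using ws by (auto simp: bs_def distinct_map inj_on_def)
  have cs: "set cs = Pair x ` N x" "distinct cs"
    using vs by (auto simp: cs_def distinct_map inj_on_def)

  have or2: "orients xs2 (R \<union> (A \<union> A\<inverse>))"
    unfolding xs2_def
  proof (rule orients_append[OF xs1 _ _ R(2)])
    show "orients as (A \<union> A\<inverse>)"
      using orients_symcl[of as] as xNM(3) by (auto simp: A_def)
    show "R \<inter> (A \<union> A\<inverse>) = {}"
      using xNM(3) by (auto simp: R_def A_def)
  qed (auto simp: sym_def)
  have or3: "orients xs3 (R \<union> (A \<union> A\<inverse>) \<union> (set bs \<union> (set bs)\<inverse>))"
    unfolding xs3_def
  proof (rule orients_append[OF or2])
    show "orients bs (set bs \<union> (set bs)\<inverse>)"
      using c xNM(3) bs by (intro orients_symcl) auto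
    show "(R \<union> (A \<union> A\<inverse>)) \<inter> (set bs \<union> (set bs)\<inverse>) = {}"
      using xNM(3) c by (auto simp: R_def A_def bs)
  qed (use R(2) in \<open>auto simp: sym_def\<close>)
  have "orients xs4 (R \<union> (A \<union> A\<inverse>) \<union> (set bs \<union> (set bs)\<inverse>) \<union> (set cs \<union> (set cs)\<inverse>))"
    unfolding xs4_def
  proof (rule orients_append[OF or3])
    show "orients cs (set cs \<union> (set cs)\<inverse>)"
      using cs xNM(1) by (intro orients_symcl) auto
    show "(R \<union> (A \<union> A\<inverse>) \<union> (set bs \<union> (set bs)\<inverse>)) \<inter> (set cs \<union> (set cs)\<inverse>) = {}"
      using xNM c by (auto simp: R_def A_def bs cs)
  qed (use R(2) in \<open>auto simp: sym_def\<close>)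
  moreover have "R \<union> (A \<union> A\<inverse>) \<union> (set bs \<union> (set bs)\<inverse>) \<union> (set cs \<union> (set cs)\<inverse>) = E" (is "?U = E")
  proof
    show "?U \<subseteq> E"
      using c E(1) by (auto simp: R_def A_def bs cs N_def dest: symD)
    show "E \<subseteq> ?U"
    proof (rule subrelI)
      fix u v assume uv: "(u, v) \<in> E"
      have vu: "(v, u) \<in> E" using uv E(1) by (auto dest: symD)
      have "u \<in> V" "v \<in> V" using uv V(2) by auto
      then consider "u = x" | "v = x" | "u \<in> N x" "v \<in> N x" | "u \<in> M" "v \<in> M"
        | "u \<in> M" "v \<in> N x" | "u \<in> N x" "v \<in> M"
        using xNM(4) by auto
      then show "(u, v) \<in> ?U"
        by cases (use uv vu in \<open>auto simp: R_def A_def bs cs N_def\<close>)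
    qed
  qed
  ultimately have orient: "orients xs4 E"
    by (rule back_subst[of "orients xs4"])

  have sum_N: "list_sum xs4 v > 0" if "v \<in> N x" for v
  proof -
    note mem = that
    obtain i where i: "i < length vs" "v = vs ! i"
      using mem unfolding vs(1)[symmetric] in_set_conv_nth by blast
    have "v \<notin> M" using that xNM(3) by auto
    then have "list_sum xs3 v \<ge> list_sum xs2 v"
      unfolding xs3_def by (intro list_sum_append_ge) (auto simp: bs)
    moreover have "list_sum xs2 v \<ge> list_sum xs1 v"
      unfolding xs2_def using \<open>v \<notin> M\<close> by (intro list_sum_append_ge) (auto simp: as A_def)
    moreover have "list_sum xs1 v \<ge> - int (length xs0)"
      using xs0(2)[of v] \<open>v \<notin> M\<close> by (simp add: sum1)
    moreover have "length xs3 \<ge> length xs0"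
      by (simp add: xs3_def xs2_def xs1_def)
    ultimately show ?thesis
      using vs_eq[OF i(1)] i(2) by simp
  qed
  have sum_M_eq: "list_sum xs4 w = list_sum xs3 w" if "w \<in> M" for w
    unfolding xs4_def using that xNM by (intro list_sum_append_other) (auto simp: cs)
  have sum_M: "list_sum xs4 w < 0" if "w \<in> M" for w
  proof -
    note mem = that
    obtain i where i: "i < length ws" "w = ws ! i"
      using mem unfolding ws(1)[symmetric] in_set_conv_nth by blast
    have "w \<notin> N x" using that xNM(3) by auto
    then have "list_sum xs2 w \<le> list_sum xs1 w"
      unfolding xs2_def by (intro list_sum_append_le) (auto simp: as A_def)
    moreover have "list_sum xs1 w \<le> int (length xs0)"
      using xs0(2)[of w] that by (simp add: sum1)
    moreover have "length xs2 \<ge> length xs0"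
      by (simp add: xs2_def xs1_def)
    ultimately show ?thesis
      using ws_eq[OF i(1)] i(2) sum_M_eq[OF that] by simp
  qed
  have inj_N: "inj_on (list_sum xs4) (N x)"
  proof (rule inj_onI)
    fix u v assume uv: "u \<in> N x" "v \<in> N x" "list_sum xs4 u = list_sum xs4 v"
    then obtain i j where "i < length vs" "j < length vs" "u = vs ! i" "v = vs ! j"
      unfolding vs(1)[symmetric] in_set_conv_nth by blast
    then show "u = v"
      using vs_less[of i j] vs_less[of j i] uv(3) by (cases i j rule: linorder_cases) auto
  qed
  have inj_M: "inj_on (list_sum xs4) M"
  proof (rule inj_onI)
    fix u v assume uv: "u \<in> M" "v \<in> M" "list_sum xs4 u = list_sum xs4 v"
    then obtain i j where "i < length ws" "j < length ws" "u = ws ! i" "v = ws ! j"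
      unfolding ws(1)[symmetric] in_set_conv_nth by blast
    then show "u = v"
      using ws_less[of i j] ws_less[of j i] uv sum_M_eq
      by (cases i j rule: linorder_cases) auto
  qed
  have card_pos: "card (N x) > 0"
    using x(2) fin(3) by (simp add: card_gt_0_iff)
  have out_cs: "{a \<in> set cs. fst a = x} = Pair x ` N x"
    by (auto simp: cs)
  have "list_sum xs3 x = 0"
  proof -
    have "set xs3 \<subseteq> R \<union> (A \<union> A\<inverse>) \<union> (set bs \<union> (set bs)\<inverse>)"
      using or3 by (simp add: orients_def)
    also have "\<dots> \<subseteq> (N x \<union> M) \<times> (N x \<union> M)"
      using c by (auto simp: R_def A_def bs)
    finally have "fst a \<noteq> x \<and> snd a \<noteq> x" if "a \<in> set xs3" for a
      using that xNM(1,2) by (auto dest!: subsetD)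
    then show ?thesis
      using list_sum_append_other[of xs3 x "[]"] by simp
  qed
  moreover have "list_sum xs4 x \<le> list_sum xs3 x - int (length xs3 + 1) * int (card {a \<in> set cs. fst a = x})"
    unfolding xs4_def by (intro list_sum_append_source_le) (use cs xNM(1) in auto)
  ultimately have sum_x: "list_sum xs4 x \<le> - (int (length xs3 + 1) * int (card (N x)))"
    unfolding out_cs by (simp add: card_image inj_on_def)
  \<comment> \<open>Here the maximality of the degree of \<open>x\<close> enters: \<open>w\<close> has no more outgoing arcs than \<open>x\<close>, and
    all of them carry smaller labels.\<close>
  have sum_x_M: "list_sum xs4 x < list_sum xs4 w" if "w \<in> M" for w
  proof -
    have "w \<in> V" using that by (simp add: M_def)
    have "distinct xs3" "set xs3 \<subseteq> E"
      using orient by (auto simp: orients_def xs4_def)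
    then have "{a \<in> set xs3. fst a = w} \<subseteq> Pair w ` N w"
      by (auto simp: N_def)
    then have "card {a \<in> set xs3. fst a = w} \<le> card (N w)"
      by (intro surj_card_le) (auto simp: fin)
    also have "\<dots> \<le> card (N x)" using x(3) \<open>w \<in> V\<close> by blast
    finally have "int (length xs3) * int (card {a \<in> set xs3. fst a = w}) \<le>
        int (length xs3) * int (card (N x))"
      by (intro mult_left_mono) auto
    also have "\<dots> < int (length xs3 + 1) * int (card (N x))"
      using card_pos by (intro mult_strict_right_mono) auto
    finally show ?thesis
      using sum_x list_sum_ge_out_degree[OF \<open>distinct xs3\<close>, of w] sum_M_eq[OF that] by linarith
  qed
  have "int (length xs3 + 1) * int (card (N x)) \<ge> 0"
    by simp
  then have sum_x_neg: "list_sum xs4 x \<le> 0"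
    using sum_x by linarith
  have "inj_on (list_sum xs4) (N x \<union> M)"
  proof (rule inj_on_UnI[OF inj_N inj_M])
    fix v w assume "v \<in> N x" "w \<in> M"
    then show "list_sum xs4 v \<noteq> list_sum xs4 w"
      using sum_N[of v] sum_M[of w] by simp
  qed
  then have "inj_on (list_sum xs4) ({x} \<union> (N x \<union> M))"
  proof (rule inj_on_UnI[rotated])
    fix z v assume "z \<in> {x}" "v \<in> N x \<union> M"
    then show "list_sum xs4 z \<noteq> list_sum xs4 v"
      using sum_N[of v] sum_x_neg sum_x_M[of v] by auto
  qed simp
  then have "inj_on (list_sum xs4) V"
    using xNM(4) by simp
  then show ?thesis using orient by blast
qed

section \<open>Graphs partitioned by two stars\<close>

text \<open>
  With both stars directed to their leaves, the only possible coincidence of sums is between the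
  two centres. In that case both sums are at most \<open>-4h\<close>, where \<open>h\<close> is the smallest label used for the
  stars, because one of the centres has at least four leaves. The arc with label \<open>h\<close> ends in the leaf of
  least sum; reversing it lowers this sum by \<open>2h\<close> and raises that of one centre by \<open>2h\<close>. The
  lowered sum exceeds \<open>-2h\<close> and is still the least among the leaves, and both centres stay at or
  below \<open>-2h\<close>.
\<close>

lemma antimagic_if_two_stars:
  fixes E :: "('a \<times> 'a) set"
  defines "N \<equiv> \<lambda>u. E `` {u}"
  assumes V: "finite V" "E \<subseteq> V \<times> V" and E: "sym E" "irrefl E"
    and span: "V = {x, w} \<union> N x \<union> N w" and disj: "N x \<inter> N w = {}"
    and xw: "x \<noteq> w" "(x, w) \<notin> E" and big: "card (N x) \<ge> 4"
  shows "\<exists>xs. orients xs E \<and> inj_on (list_sum xs) V"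
proof -
  define S where "S = N x \<union> N w"
  define c where "c v = (if v \<in> N x then x else w)" for v
  have fin: "finite E" "finite S" "\<And>u. finite (N u)"
    using V by (auto simp: S_def N_def intro: finite_subset[OF V(2)] finite_subset[of _ V])
  have xwS: "x \<notin> S" "w \<notin> S"
    using xw E by (auto simp: S_def N_def irrefl_def sym_def)
  have cS: "c v \<notin> S" "(c v, v) \<in> E" "c v = x \<or> c v = w" if "v \<in> S" for v
    using that xwS by (auto simp: c_def S_def N_def)
  define R where "R = E \<inter> (S \<times> S)"
  have R: "finite R" "sym R" "irrefl R"
    using fin(1) E by (auto simp: R_def sym_def irrefl_def)
  obtain xs where xs: "orients xs R" "\<And>z. list_sum xs z \<ge> - int (length xs)"
    using lower_bounded_orientation[OF R] by blast
  obtain vs where vs: "set vs = S" "distinct vs"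
    and vs_eq: "\<And>i. i < length vs \<Longrightarrow>
       list_sum (xs @ map (\<lambda>v. (c v, v)) vs) (vs ! i) =
       list_sum xs (vs ! i) + int (length xs + Suc i)"
    and vs_less: "\<And>i j. i < j \<Longrightarrow> j < length vs \<Longrightarrow>
       list_sum (xs @ map (\<lambda>v. (c v, v)) vs) (vs ! i) <
       list_sum (xs @ map (\<lambda>v. (c v, v)) vs) (vs ! j)"
    using star_extension[of S c xs] fin(2) cS(1) by blast
  define f where "f = list_sum (xs @ map (\<lambda>v. (c v, v)) vs)"
  define h where "h = int (length xs + 1)"
  note vs_eq = vs_eq[folded f_def] and vs_less = vs_less[folded f_def]

  \<comment> \<open>Stated for any choice of directions of the star edges, since one of them may be reversed.\<close>
  have star_orients: "orients (xs @ ys) E"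
    if "distinct ys" "set ys \<inter> (set ys)\<inverse> = {}" "set ys \<union> (set ys)\<inverse> = (\<lambda>v. (c v, v)) ` S \<union> ((\<lambda>v. (c v, v)) ` S)\<inverse>" for ys
  proof -
    have "orients (xs @ ys) (R \<union> (set ys \<union> (set ys)\<inverse>))"
    proof (rule orients_append[OF xs(1) orients_symcl[OF that(1,2)] _ R(2)])
      show "R \<inter> (set ys \<union> (set ys)\<inverse>) = {}"
        unfolding that(3) using cS(1) by (auto simp: R_def)
    qed (auto simp: sym_def)
    moreover have "R \<union> (set ys \<union> (set ys)\<inverse>) = E" (is "?U = E")
    proof
      show "?U \<subseteq> E"
        unfolding that(3) using cS(2) E(1) by (auto simp: R_def dest: symD)
      show "E \<subseteq> ?U"
      proof (rule subrelI)
        fix u v assume uv: "(u, v) \<in> E"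
        have vu: "(v, u) \<in> E" using uv E(1) by (auto dest: symD)
        have "(u, v) \<noteq> (x, w)" "(u, v) \<noteq> (w, x)" "u \<noteq> v"
          using uv vu xw E(2) by (auto simp: irrefl_def)
        moreover have "u \<in> V" "v \<in> V" using uv V(2) by auto
        ultimately consider "u \<in> S" "v \<in> S" | "u \<in> {x, w}" "v \<in> S" | "u \<in> S" "v \<in> {x, w}"
          using span unfolding S_def by blast
        then show "(u, v) \<in> ?U"
        proof cases
          case 1 then show ?thesis using uv by (simp add: R_def)
        next
          case 2
          then have "c v = u" using uv disj by (auto simp: c_def N_def)
          then show ?thesis unfolding that(3) using 2 by auto
        next
          case 3
          then have "c u = v" using vu disj by (auto simp: c_def N_def)
          then show ?thesis unfolding that(3) using 3 by auto
        qed
      qed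
    qed
    ultimately show ?thesis
      by (rule back_subst[of "orients (xs @ ys)"])
  qed

  have f_leaf: "f v > 0" if "v \<in> S" for v
  proof -
    note mem = that
    obtain i where i: "i < length vs" "v = vs ! i"
      using mem unfolding vs(1)[symmetric] in_set_conv_nth by blast
    then show ?thesis using vs_eq[OF i(1)] xs(2)[of v] by simp
  qed
  have inj_S: "inj_on f S"
  proof (rule inj_onI)
    fix u v assume uv: "u \<in> S" "v \<in> S" "f u = f v"
    then obtain i j where "i < length vs" "j < length vs" "u = vs ! i" "v = vs ! j"
      unfolding vs(1)[symmetric] in_set_conv_nth by blast
    then show "u = v"
      using vs_less[of i j] vs_less[of j i] uv(3) by (cases i j rule: linorder_cases) auto
  qed
  have f_centre: "f z \<le> - (h * int (card (N z)))" if "z \<in> {x, w}" for z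
  proof -
    have "z \<notin> S" using that xwS by auto
    have "{v \<in> S. c v = z} = N z"
      using that xw(1) disj by (auto simp: c_def S_def split: if_splits)
    moreover have "{a \<in> set (map (\<lambda>v. (c v, v)) vs). fst a = z} = Pair z ` {v \<in> S. c v = z}"
      by (auto simp: vs(1))
    ultimately have "{a \<in> set (map (\<lambda>v. (c v, v)) vs). fst a = z} = Pair z ` N z"
      by simp
    then have "card {a \<in> set (map (\<lambda>v. (c v, v)) vs). fst a = z} = card (N z)"
      by (simp add: card_image inj_on_def)
    moreover have "list_sum xs z = 0"
    proof -
      have "fst a \<noteq> z \<and> snd a \<noteq> z" if "a \<in> set xs" for a
        using that xs(1) \<open>z \<notin> S\<close> by (auto simp: orients_def R_def)
      then show ?thesis
        using list_sum_append_other[of xs z "[]"] by simp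
    qed
    moreover have "f z \<le> list_sum xs z -
        int (length xs + 1) * int (card {a \<in> set (map (\<lambda>v. (c v, v)) vs). fst a = z})"
      unfolding f_def using vs \<open>z \<notin> S\<close>
      by (intro list_sum_append_source_le) (auto simp: distinct_map inj_on_def)
    ultimately show ?thesis by (simp add: h_def)
  qed
  have f_centre_nonpos: "f z \<le> 0" if "z \<in> {x, w}" for z
  proof -
    have "h * int (card (N z)) \<ge> 0" by (simp add: h_def)
    then show ?thesis using f_centre[OF that] by linarith
  qed
  have V_eq: "V = {x, w} \<union> S"
    using span by (auto simp: S_def)
  show ?thesis
  proof (cases "f x = f w")
    case False
    have "inj_on f ({x, w} \<union> S)"
    proof (rule inj_on_UnI[OF _ inj_S])
      show "inj_on f {x, w}"
        using False by (auto simp: inj_on_def)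
      show "f z \<noteq> f v" if "z \<in> {x, w}" "v \<in> S" for z v
        using f_centre_nonpos[OF that(1)] f_leaf[OF that(2)] by simp
    qed
    moreover have "orients (xs @ map (\<lambda>v. (c v, v)) vs) E"
      using vs cS(1) by (intro star_orients) (auto simp: distinct_map inj_on_def)
    ultimately show ?thesis unfolding V_eq f_def by blast
  next
    case True
    have "S \<noteq> {}" using big by (auto simp: S_def)
    then obtain v0 us where vs_Cons: "vs = v0 # us"
      using vs(1) by (cases vs) auto
    define ys where "ys = (v0, c v0) # map (\<lambda>v. (c v, v)) us"
    define g where "g = list_sum (xs @ ys)"
    have v0: "v0 \<in> S" using vs(1) vs_Cons by auto
    have g: "g z = f z - 2 * h * incidence (c v0, v0) z" for z
      using list_sum_reverse_arc[of xs "(c v0, v0)" "map (\<lambda>v. (c v, v)) us" z]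
      by (simp add: g_def f_def ys_def vs_Cons h_def)
    have "c v0 \<noteq> v0" using cS(1) v0 by metis
    have h: "h > 0" by (simp add: h_def)
    have "h * int (card (N x)) \<ge> h * 4"
      using big h by (intro mult_left_mono) auto
    \<comment> \<open>The bound comes from \<open>x\<close> and is inherited by \<open>w\<close>, however few leaves \<open>w\<close> has, since the two
      sums agree.\<close>
    then have centre: "f z \<le> - 4 * h" if "z \<in> {x, w}" for z
      using f_centre[of x] True that by auto
    have g_v0: "g v0 = f v0 - 2 * h"
      using \<open>c v0 \<noteq> v0\<close> by (simp add: g incidence_def)
    have g_leaf: "g v = f v" if "v \<in> S" "v \<noteq> v0" for v
      using that cS(1)[OF v0] by (auto simp: g incidence_def)
    have g_centre: "g z = f z + (if z = c v0 then 2 * h else 0)" if "z \<in> {x, w}" for z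
      using that xwS v0 by (auto simp: g incidence_def)
    have least: "f v0 < f v" if "v \<in> S" "v \<noteq> v0" for v
    proof -
      note mem = that(1)
      obtain i where i: "i < length vs" "v = vs ! i"
        using mem unfolding vs(1)[symmetric] in_set_conv_nth by blast
      then have "i \<noteq> 0" using that(2) vs_Cons by (cases i) auto
      then show ?thesis using vs_less[of 0 i] i vs_Cons by simp
    qed
    have lower: "g v > - 2 * h" if "v \<in> S" for v
      using f_leaf[OF that] g_v0 g_leaf[OF that] h by (cases "v = v0") auto
    have "g u \<noteq> g v" if "u \<in> S" "v \<in> S" "u \<noteq> v" for u v
    proof -
      consider "u = v0" | "v = v0" | "u \<noteq> v0" "v \<noteq> v0" by blast
      then show ?thesis
        using that g_v0 g_leaf[of u] g_leaf[of v] least[of u] least[of v] h inj_onD[OF inj_S, of u v]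
        by cases auto
    qed
    then have "inj_on g S" by (auto simp: inj_on_def)
    have "inj_on g ({x, w} \<union> S)"
    proof (rule inj_on_UnI[OF _ \<open>inj_on g S\<close>])
      have "g x \<noteq> g w"
        using g_centre[of x] g_centre[of w] True xw(1) cS(3)[OF v0] h by auto
      then show "inj_on g {x, w}" by (auto simp: inj_on_def)
      show "g z \<noteq> g v" if "z \<in> {x, w}" "v \<in> S" for z v
      proof -
        have "g z \<le> - 2 * h"
          using g_centre[OF that(1)] centre[OF that(1)] h by (auto split: if_splits)
        then show ?thesis using lower[OF that(2)] by simp
      qed
    qed
    moreover have "orients (xs @ ys) E"
    proof (rule star_orients)
      show "distinct ys"
        using vs(2) cS(1)[OF v0] vs(1) by (auto simp: ys_def vs_Cons distinct_map inj_on_def)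
      show "set ys \<inter> (set ys)\<inverse> = {}"
        using vs cS(1) v0 by (auto simp: ys_def vs_Cons)
      show "set ys \<union> (set ys)\<inverse> = (\<lambda>v. (c v, v)) ` S \<union> ((\<lambda>v. (c v, v)) ` S)\<inverse>"
        unfolding vs(1)[symmetric] vs_Cons ys_def by auto
    qed
    ultimately show ?thesis unfolding V_eq g_def by blast
  qed
qed

section \<open>Graphs with large maximum and minimum degree\<close>

lemma antimagic_orientation_of_list:
  assumes or: "orients xs (parcs G)" and inj: "inj_on (list_sum xs) (pverts G)"
  shows "\<exists>D \<tau>. antimagic_orientation G (D, \<tau>)"
proof -
  define D where "D = \<lparr>pverts = pverts G, parcs = set xs\<rparr>"
  define \<tau> where "\<tau> = Suc \<circ> the_inv_into {..<length xs} (nth xs)"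
  have dist: "distinct xs" using or by (simp add: orients_def)
  have bij: "bij_betw (nth xs) {..<length xs} (set xs)"
    using bij_betw_nth[OF dist] by simp
  have \<tau>: "\<tau> (xs ! i) = Suc i" if "i < length xs" for i
    using that bij by (simp add: \<tau>_def the_inv_into_f_f bij_betw_def)
  have "bij_betw Suc {..<length xs} {1..length xs}"
    by (simp add: bij_betw_def image_Suc_lessThan)
  then have "bij_betw \<tau> (set xs) {1..length xs}"
    unfolding \<tau>_def using bij_betw_the_inv_into[OF bij] bij_betw_trans by blast
  then have bij_\<tau>: "bij_betw \<tau> (parcs D) {1..card (parcs D)}"
    by (simp add: D_def distinct_card[OF dist])
  have "vertex_sum D \<tau> v = list_sum xs v" for v
  proof -
    have "vertex_sum D \<tau> v = (\<Sum>a\<in>set xs. int (\<tau> a) * of_bool (snd a = v))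
        - (\<Sum>a\<in>set xs. int (\<tau> a) * of_bool (fst a = v))"
      unfolding vertex_sum_def in_arcs_def out_arcs_def with_proj_simps D_def
      by (simp add: sum.If_cases of_bool_def Int_def conj_commute if_distrib cong: if_cong)
    also have "\<dots> = (\<Sum>a\<in>set xs. int (\<tau> a) * incidence a v)"
      by (simp add: incidence_def sum_subtractf right_diff_distrib)
    also have "\<dots> = (\<Sum>i<length xs. int (\<tau> (xs ! i)) * incidence (xs ! i) v)"
      by (rule sum.reindex_bij_betw[OF bij, symmetric])
    also have "\<dots> = list_sum xs v"
      by (simp add: list_sum_def \<tau>)
    finally show ?thesis .
  qed
  then have "antimagic_labeling D \<tau>"
    using inj bij_\<tau> by (auto simp: antimagic_labeling_def D_def inj_on_def)
  moreover have "is_orientation G D"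
    using or by (auto simp: is_orientation_def D_def orients_def)
  ultimately show ?thesis
    by (auto simp: antimagic_orientation_def)
qed

theorem corollary1p9:
  fixes G :: "'a pair_pre_digraph"
  assumes "pair_graph G"
    and "card (pverts G) \<ge> 9"
    and "max_degree G + min_degree G \<ge> card (pverts G) - 2"
  shows "\<exists>D \<tau>. antimagic_orientation G (D, \<tau>)"
proof -
  interpret pair_graph G by (rule assms(1))
  define V where "V = pverts G"
  define E where "E = parcs G"
  define N where "N u = E `` {u}" for u
  have V: "finite V" "E \<subseteq> V \<times> V" and "sym E"
    using pair_finite_verts in_arcsD1 in_arcsD2 pair_sym_arcs
    by (auto simp: V_def E_def symmetric_def)
  have "irrefl E"
    using pair_no_loops unfolding E_def irrefl_def by fastforce
  note E = \<open>sym E\<close> \<open>irrefl E\<close>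
  have finN: "finite (N u)" for u
    using V by (auto simp: N_def intro: finite_subset[of _ V])
  have deg: "out_degree (with_proj G) u = card (N u)" for u
  proof -
    have "out_arcs (with_proj G) u = Pair u ` N u"
      by (auto simp: out_arcs_def N_def E_def)
    then show ?thesis by (simp add: out_degree_def card_image inj_on_def)
  qed
  have "V \<noteq> {}" using assms(2) by (auto simp: V_def)
  have max_deg: "max_degree G = Max ((\<lambda>u. card (N u)) ` V)"
    and min_deg: "min_degree G = Min ((\<lambda>u. card (N u)) ` V)"
    by (simp_all add: max_degree_def min_degree_def deg V_def)
  have "max_degree G \<in> (\<lambda>u. card (N u)) ` V"
    unfolding max_deg using V(1) \<open>V \<noteq> {}\<close> by (intro Max_in) auto
  then obtain x where x: "x \<in> V" "card (N x) = max_degree G" by auto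
  have le_max: "card (N u) \<le> card (N x)" and ge_min: "min_degree G \<le> card (N u)" if "u \<in> V" for u
    unfolding x(2) unfolding max_deg min_deg using that V(1) by auto
  \<comment> \<open>The two degrees add up to at least 7, and the maximum is at least half of that.\<close>
  have big: "card (N x) \<ge> 4"
    using ge_min[OF x(1)] assms(2,3) x(2) by simp
  have "\<exists>xs. orients xs E \<and> inj_on (list_sum xs) V"
  proof (cases "\<forall>w\<in>V. w \<noteq> x \<longrightarrow> w \<notin> N x \<longrightarrow> N w \<inter> N x \<noteq> {}")
    case True
    have "N x \<noteq> {}" using big by auto
    then show ?thesis
      using antimagic_if_common_neighbours[OF V E x(1)] le_max True by (simp add: N_def)
  next
    case False
    then obtain w where w: "w \<in> V" "w \<noteq> x" "w \<notin> N x" and disj: "N x \<inter> N w = {}"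
      by blast
    define M where "M = V - insert x (insert w (N x))"
    have sub: "N u \<subseteq> V" for u using V(2) by (auto simp: N_def)
    have "x \<notin> N w" using w(3) E(1) by (auto simp: N_def dest: symD)
    moreover have "x \<notin> N x" "w \<notin> N w" using E(2) by (auto simp: N_def irrefl_def)
    ultimately have subM: "N w \<subseteq> M" using sub[of w] disj by (auto simp: M_def)
    have "card (insert x (insert w (N x))) = card (N x) + 2"
      using w \<open>x \<notin> N x\<close> finN by simp
    then have "card M = card V - (card (N x) + 2)"
      unfolding M_def using x(1) w(1) sub[of x] finN by (subst card_Diff_subset) auto
    \<comment> \<open>This is where the degree condition is needed: \<open>N w\<close> lies in \<open>M\<close>, which has at most
      \<open>min_degree G\<close> elements.\<close>
    then have "card M \<le> card (N w)"
      using ge_min[OF w(1)] assms(3) x(2) by (simp add: V_def)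
    then have "N w = M"
      using subM V(1) by (intro card_seteq) (auto simp: M_def)
    then have "V = {x, w} \<union> N x \<union> N w"
      using x(1) w(1) sub[of x] by (auto simp: M_def)
    then show ?thesis
      using antimagic_if_two_stars[OF V E, of x w] disj w(2,3) big by (simp add: N_def)
  qed
  then obtain xs where "orients xs E" "inj_on (list_sum xs) V"
    by blast
  then show ?thesis
    unfolding E_def V_def by (rule antimagic_orientation_of_list)
qed

end
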